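(* For every integer $n\ge 0$, the polynomial $y=H_n(x)$ satisfies the differential equation $$ (x-1)(x-3)\,\frac{d^2y}{dx^2} + \left( 2(n+2)(x-3)+3 \right) \frac{dy}{dx} - 3n(n+1)\,y = 0. $$
   Context: For $k\ge 0$ let $a_k(x)=\sum_{m=0}^{k}\binom{3k+1-m}{k-m}x^m$, and for $n\ge 0$ let $H_n(x)=\det[a_{i+j}(x)]_{0\le i,j\le n}$ be the $(n+1)\times(n+1)$ Hankel determinant. *)

theory Defs
  imports "HOL-Computational_Algebra.Polynomial" "Jordan_Normal_Form.Determinant"
begin

(* The subtractions on nat never truncate, since m \<le> k. *)
definition a :: "nat \<Rightarrow> real poly" where
  "a k = (\<Sum>m = 0..k. monom (real ((3 * k + 1 - m) choose (k - m))) m)"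

definition H :: "nat \<Rightarrow> real poly" where
  "H n = det (mat (n + 1) (n + 1) (\<lambda>(i, j). a (i + j)))"

end

theory Submission
  imports Defs "HOL-Computational_Algebra.Formal_Power_Series"
begin

text \<open>
  Put \<open>y = x - 1\<close> and let \<open>U\<close> be the power series with \<open>U = X (1 + U)\<^sup>3\<close>. The generating function
  \<open>A = \<Sum>k. a k X\<^sup>k\<close> is algebraic, and \<open>1 / A = 1 - (5 + y) X - X ((3 - 2y) U + U\<^sup>2)\<close>. One
  step of a continued fraction therefore turns the Hankel determinant of \<open>A\<close> of order \<open>n + 1\<close> into the
  one of order \<open>n\<close> of \<open>(3 - 2y) U + U\<^sup>2\<close> (\<open>det_hankel_step\<close>, \<open>det_a_hankel\<close>), whose matrix is a linear
  pencil \<open>M\<^sub>y = M\<^sub>0 - 2y B\<close> with \<open>B\<close> the Hankel matrix of \<open>U\<close>.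

  Write \<open>s = 1 / X\<close>. The cubic equation of \<open>U\<close> over the polynomials in \<open>s\<close> gives
  \<open>U\<^sup>p\<^sup>+\<^sup>1 = Q\<^sub>p(s) - c\<^sub>p(s) / U + c\<^sub>p\<^sub>+\<^sub>1(s) U\<close>, and the coefficients of \<open>c\<^sub>p\<close> are, up to sign, the binomial
  coefficients \<open>(p + l + 1 choose 3l + 2)\<close>. For \<open>n \<le> p < 2n\<close> the coefficients of \<open>X, \<dots>, X\<^sup>n\<close> of the
  left-hand side vanish, which says that \<open>M\<^sub>0 d\<^sub>p = B d\<^sub>p\<^sub>+\<^sub>1\<close> for the vectors \<open>d\<^sub>p\<close> of these binomial
  coefficients. Hence in the basis \<open>d\<^sub>n, \<dots>, d\<^sub>2\<^sub>n\<^sub>-\<^sub>1\<close> the matrix \<open>B\<^sup>-\<^sup>1 M\<^sub>0\<close> is a companion matrix, and its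
  characteristic polynomial at \<open>2y\<close> is read off from the linear relation between \<open>d\<^sub>n, \<dots>, d\<^sub>2\<^sub>n\<close>. The
  coefficients of this relation are those of \<open>\<^sub>2F\<^sub>1(-n, 3n + 3; 2n + 5/2; t / 4)\<close> in \<open>t\<close>
  (\<open>hyp_coeff_orthogonal\<close>). So \<open>H n\<close> is a constant multiple of this polynomial at \<open>t = 2y\<close>
  (\<open>det_hankel_pencil\<close>, \<open>H_eq_smult_hyp_poly\<close>), and the differential equation is the
  hypergeometric one.

  The argument needs \<open>det B \<noteq> 0\<close>. This follows by induction on \<open>n\<close>: another continued fraction step
  identifies the determinant of \<open>B\<close> of order \<open>n + 1\<close> with \<open>det M\<^sub>0\<close> of order \<open>n\<close>
  (\<open>det_ternary_hankel_Suc\<close>, \<open>det_ternary_hankel_nonzero\<close>).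
\<close>

section \<open>The generating function\<close>

text \<open>
  Re-expansion around \<open>x = 1\<close>, which is one of the finite singular points of the differential
  equation.
\<close>

lemma poly_a_binomial:
  "poly (a k) x = (\<Sum>i\<le>k. real ((3 * k + 2) choose (k - i)) * (x - 1) ^ i)"
proof -
  \<comment> \<open>A recursion on \<open>k\<close> needs the upper index \<open>N\<close> of the binomials as a separate variable.\<close>
  have gen: "(\<Sum>m\<le>k. real ((N - m) choose (k - m)) * x ^ m) =
      (\<Sum>i\<le>k. real (Suc N choose (k - i)) * (x - 1) ^ i)" if "k \<le> N" for k N :: nat
    using that
  proof (induction k arbitrary: N)
    case 0
    then show ?case by simp
  next
    case (Suc k)
    then obtain M where N: "N = Suc M" and M: "k \<le> M"
      by (cases N) auto
    let ?R = "\<Sum>i\<le>k. real (Suc M choose (k - i)) * (x - 1) ^ i"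
    have "(\<Sum>m\<le>Suc k. real ((N - m) choose (Suc k - m)) * x ^ m) =
        real (N choose Suc k) + x * ?R"
      unfolding sum.atMost_Suc_shift Suc.IH[OF M, symmetric] sum_distrib_left
      by (simp add: N mult_ac)
    also have "x * ?R = ?R + (x - 1) * ?R"
      by (simp add: algebra_simps)
    also have "(x - 1) * ?R = (\<Sum>i\<le>k. real (N choose (k - i)) * (x - 1) ^ Suc i)"
      unfolding sum_distrib_left by (simp add: N mult_ac)
    also have "real (N choose Suc k) + (?R + (\<Sum>i\<le>k. real (N choose (k - i)) * (x - 1) ^ Suc i)) =
        (\<Sum>i\<le>Suc k. real (N choose (Suc k - i)) * (x - 1) ^ i) + ?R"
      unfolding sum.atMost_Suc_shift by simp
    also have "\<dots> = (\<Sum>i\<le>Suc k. real (Suc N choose (Suc k - i)) * (x - 1) ^ i)"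
    proof -
      have "(\<Sum>i\<le>k. real (Suc N choose (Suc k - i)) * (x - 1) ^ i) =
          (\<Sum>i\<le>k. real (N choose (Suc k - i)) * (x - 1) ^ i) + ?R"
        unfolding sum.distrib[symmetric]
        by (intro sum.cong refl) (simp add: N Suc_diff_le algebra_simps)
      then show ?thesis by simp
    qed
    finally show ?case .
  qed
  show ?thesis
    unfolding a_def
    using gen[of k "3 * k + 1"] by (simp add: poly_sum poly_monom atLeast0AtMost)
qed

text \<open>
  The generating function \<open>U\<close> of ternary trees without the empty tree, defined as the
  compositional inverse of \<open>X / (1 + X)\<^sup>3\<close>, so that \<open>U = X (1 + U)\<^sup>3\<close>.
\<close>

definition ternary_fps :: "real fps" where
  "ternary_fps = fps_inv (fps_X * inverse ((1 + fps_X) ^ 3))"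

lemma ternary_fps_nth_0 [simp]: "fps_nth ternary_fps 0 = 0"
  by (simp add: ternary_fps_def fps_inv_def)

lemma ternary_fps_eq: "ternary_fps = fps_X * (1 + ternary_fps) ^ 3"
proof -
  let ?A = "fps_X * inverse ((1 + fps_X) ^ 3) :: real fps"
  let ?U = ternary_fps
  have "?A oo ?U = fps_X"
    unfolding ternary_fps_def by (rule fps_inv_right) simp_all
  moreover have "?A * (1 + fps_X) ^ 3 = fps_X"
    by (simp add: mult.assoc inverse_mult_eq_1)
  moreover have "fps_X oo ?U = ?U"
    by simp
  ultimately have "(?A oo ?U) * ((1 + fps_X) ^ 3 oo ?U) = ?U"
    by (metis fps_compose_mult_distrib ternary_fps_nth_0)
  with \<open>?A oo ?U = fps_X\<close> show ?thesis
    by (simp add: fps_compose_add_distrib flip: fps_compose_power)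
qed

text \<open>
  The series \<open>\<Sum>k. (3k + r choose k - e) X\<^sup>k\<close>, where the binomial coefficient is read as \<open>0\<close> for
  \<open>k < e\<close>; the explicit case distinction is needed because subtraction on \<^typ>\<open>nat\<close> truncates.
\<close>

definition binom_fps :: "nat \<Rightarrow> nat \<Rightarrow> real fps" where
  "binom_fps r e = Abs_fps (\<lambda>k. if e \<le> k then real ((3 * k + r) choose (k - e)) else 0)"

lemma binom_fps_nth:
  "fps_nth (binom_fps r e) k = (if e \<le> k then real ((3 * k + r) choose (k - e)) else 0)"
  by (simp add: binom_fps_def)

lemma binom_fps_Suc_left: "binom_fps (Suc r) e = binom_fps r e + binom_fps r (Suc e)"
proof (rule fps_ext)
  fix k
  consider "k < e" | "k = e" | d where "e \<le> k" "k - e = Suc d" "k - Suc e = d" "Suc e \<le> k"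
    by (metis Suc_diff_Suc Suc_leI less_or_eq_imp_le linorder_neqE_nat)
  then show "fps_nth (binom_fps (Suc r) e) k = fps_nth (binom_fps r e + binom_fps r (Suc e)) k"
    by cases (simp_all add: binom_fps_nth)
qed

lemma binom_fps_Suc_right: "binom_fps r (Suc e) =
  fps_X * (binom_fps r e + 3 * binom_fps r (Suc e) + 3 * binom_fps r (Suc (Suc e))
    + binom_fps r (Suc (Suc (Suc e))))"
proof -
  have "binom_fps r (Suc e) = fps_X * binom_fps (Suc (Suc (Suc r))) e"
  proof (rule fps_ext)
    fix k
    have "3 * Suc j + r = 3 * j + Suc (Suc (Suc r))" for j
      by simp
    then show "fps_nth (binom_fps r (Suc e)) k =
        fps_nth (fps_X * binom_fps (Suc (Suc (Suc r))) e) k"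
      by (cases k) (simp_all only: binom_fps_nth fps_X_mult_nth, simp_all del: mult_Suc_right)
  qed
  then show ?thesis
    by (simp add: binom_fps_Suc_left algebra_simps)
qed

text \<open>
  Three applications of Pascal's rule show that the series \<open>W e = binom_fps r e\<close> satisfy
  \<open>W (e + 1) = X (W e + 3 W (e + 1) + 3 W (e + 2) + W (e + 3))\<close>. This system determines all
  coefficients of the \<open>W (e + 1)\<close> from \<open>W 0\<close>, and \<open>U\<^sup>e W 0\<close> satisfies it as well because
  \<open>U = X (1 + U)\<^sup>3\<close>. This takes the place of Lagrange inversion.
\<close>

lemma binom_fps_shift: "binom_fps r (Suc e) = ternary_fps * binom_fps r e"
proof -
  let ?U = ternary_fps
  \<comment> \<open>The defect \<open>D\<close> satisfies a homogeneous system in which every term carries a factor \<open>X\<close>,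
    so its coefficients vanish by induction on their index.\<close>
  define D where "D e = binom_fps r (Suc e) - ?U * binom_fps r e" for e
  have D_eq: "D e = fps_X * (3 * D e + 3 * D (Suc e) + (3 * ?U) * D e
      + D (Suc (Suc e)) + ?U * D (Suc e) + ?U ^ 2 * D e)" for e
  proof -
    have "D e = fps_X * (binom_fps r e + 3 * binom_fps r (Suc e) + 3 * binom_fps r (Suc (Suc e))
        + binom_fps r (Suc (Suc (Suc e)))) - fps_X * (1 + ?U) ^ 3 * binom_fps r e"
      unfolding D_def by (metis ternary_fps_eq binom_fps_Suc_right)
    then show ?thesis
      by (simp add: D_def algebra_simps power2_eq_square power3_eq_cube)
  qed
  have "\<forall>e. fps_nth (D e) k = 0" for k
  proof (induction k rule: less_induct)
    case (less k)
    show ?case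
    proof (cases k)
      case 0
      then show ?thesis by (subst D_eq) simp
    next
      case (Suc j)
      have z: "fps_nth (D e) i = 0" if "i \<le> j" for e i
        using less that Suc by auto
      have zm: "fps_nth (F * D e) j = 0" for F e
        unfolding fps_mult_nth by (intro sum.neutral) (simp add: z)
      show ?thesis
        unfolding Suc by (subst D_eq) (simp add: z zm)
    qed
  qed
  then have "D e = 0"
    by (intro fps_ext) simp
  then show ?thesis by (simp add: D_def)
qed

lemma binom_fps_add_left: "binom_fps (Suc r) e = (1 + ternary_fps) * binom_fps r e"
  by (simp add: binom_fps_Suc_left binom_fps_shift algebra_simps)

lemma one_plus_ternary_nonzero: "1 + ternary_fps \<noteq> 0"
proof
  assume "1 + ternary_fps = 0"
  then have "fps_nth (1 + ternary_fps) 0 = 0" by simp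
  then show False by simp
qed

text \<open>
  The closed form of \<open>\<Sum>k. (3k choose k) X\<^sup>k\<close>. With \<open>V = (1 - 2U) \<Sum>k. (3k choose k) X\<^sup>k\<close>, the
  absorption identity \<open>k (3k + 1 choose k) = (3k + 1) (3k choose k - 1)\<close> yields the differential
  equation \<open>V' (1 + U) = V U'\<close>, so that \<open>V / (1 + U)\<close> is constant.
\<close>

lemma central_binom_fps: "(1 - 2 * ternary_fps) * binom_fps 0 0 = 1 + ternary_fps"
proof -
  let ?U = ternary_fps and ?Y = "binom_fps 0 0"
  define V where "V = (1 - 2 * ?U) * ?Y"
  have dU: "fps_X * (1 - 2 * ?U) * fps_deriv ?U = ?U * (1 + ?U)"
  proof -
    have "fps_deriv ?U = fps_deriv (fps_X * (1 + ?U) ^ 3)"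
      by (metis ternary_fps_eq)
    then have "fps_deriv ?U = (1 + ?U) ^ 3 + 3 * fps_X * (1 + ?U) ^ 2 * fps_deriv ?U"
      by (simp add: fps_deriv_power numeral_3_eq_3 algebra_simps power2_eq_square)
    then have "fps_X * (1 + ?U) * fps_deriv ?U =
        fps_X * (1 + ?U) * ((1 + ?U) ^ 3 + 3 * fps_X * (1 + ?U) ^ 2 * fps_deriv ?U)"
      by simp
    also have "\<dots> = fps_X * (1 + ?U) ^ 3 * (1 + ?U)
        + 3 * fps_X * (fps_X * (1 + ?U) ^ 3) * fps_deriv ?U"
      by (simp add: algebra_simps power2_eq_square power3_eq_cube)
    finally have "fps_X * (1 + ?U) * fps_deriv ?U =
        fps_X * (1 + ?U) ^ 3 * (1 + ?U) + 3 * fps_X * (fps_X * (1 + ?U) ^ 3) * fps_deriv ?U" .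
    then have "fps_X * (1 + ?U) * fps_deriv ?U = ?U * (1 + ?U) + 3 * fps_X * ?U * fps_deriv ?U"
      by (metis ternary_fps_eq)
    moreover have "fps_X * (1 - 2 * ?U) * fps_deriv ?U =
        fps_X * (1 + ?U) * fps_deriv ?U - 3 * fps_X * ?U * fps_deriv ?U"
      by (simp add: algebra_simps)
    ultimately show ?thesis by simp
  qed
  have "fps_X * fps_deriv (binom_fps 1 0) =
      3 * (fps_X * fps_deriv (binom_fps 0 1)) + binom_fps 0 1"
  proof (rule fps_ext)
    fix k
    show "fps_nth (fps_X * fps_deriv (binom_fps 1 0)) k =
        fps_nth (3 * (fps_X * fps_deriv (binom_fps 0 1)) + binom_fps 0 1) k"
    proof (cases k)
      case (Suc j)
      have "Suc j * (Suc (3 * k) choose Suc j) = Suc (3 * k) * (3 * k choose j)"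
        by (rule Suc_times_binomial)
      then have "real (Suc j) * real (Suc (3 * k) choose Suc j) =
          real (Suc (3 * k)) * real (3 * k choose j)"
        by (metis of_nat_mult)
      then show ?thesis
        using Suc by (simp add: binom_fps_nth numeral_fps_const algebra_simps del: binomial_Suc_Suc)
    qed (simp add: binom_fps_nth)
  qed
  then have "fps_X * fps_deriv V = ?U * ?Y"
    unfolding V_def One_nat_def binom_fps_add_left binom_fps_shift
    by (simp add: algebra_simps) 
  moreover have "fps_X * (1 - 2 * ?U) * (fps_deriv V * (1 + ?U) - V * fps_deriv ?U) =
      (1 - 2 * ?U) * (1 + ?U) * (fps_X * fps_deriv V)
      - V * (fps_X * (1 - 2 * ?U) * fps_deriv ?U)"
    by (simp only: ring_distribs mult_ac)
  ultimately have "fps_X * (1 - 2 * ?U) * (fps_deriv V * (1 + ?U) - V * fps_deriv ?U) =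
      (1 - 2 * ?U) * (1 + ?U) * (?U * ?Y) - V * (?U * (1 + ?U))"
    by (simp only: dU)
  also have "\<dots> = 0"
    by (simp add: V_def)
  finally have "fps_X * (1 - 2 * ?U) * (fps_deriv V * (1 + ?U) - V * fps_deriv ?U) = 0" .
  moreover have "1 - 2 * ?U \<noteq> 0"
  proof
    assume "1 - 2 * ?U = 0"
    then have "fps_nth (1 - 2 * ?U) 0 = 0" by simp
    then show False by simp
  qed
  ultimately have w: "fps_deriv V * (1 + ?U) = V * fps_deriv ?U"
    by simp
  define Q where "Q = V * inverse (1 + ?U)"
  have V: "V = Q * (1 + ?U)"
    by (simp add: Q_def mult.assoc inverse_mult_eq_1)
  from w have "fps_deriv Q * (1 + ?U) ^ 2 = 0"
    unfolding V by (simp add: algebra_simps power2_eq_square)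
  then have "fps_deriv Q = 0"
    using one_plus_ternary_nonzero by simp
  then have "Q = fps_const (fps_nth Q 0)"
    by simp
  moreover have "fps_nth Q 0 = 1"
    by (simp add: Q_def V_def binom_fps_nth)
  ultimately show ?thesis
    using V by (simp add: V_def)
qed

text \<open>
  With \<open>y = x - 1\<close>, the series is \<open>\<Sum>i. y\<^sup>i U\<^sup>i W\<close> for \<open>W = binom_fps 2 0\<close>, a geometric series
  in \<open>y U\<close>, and \<open>W\<close> follows from the closed form above.
\<close>

lemma a_fps:
  "Abs_fps (\<lambda>k. poly (a k) x) * (1 - 2 * ternary_fps) * (1 - fps_const (x - 1) * ternary_fps)
    = (1 + ternary_fps) ^ 3"
proof -
  let ?U = ternary_fps and ?A = "Abs_fps (\<lambda>k. poly (a k) x)" and ?y = "x - 1"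
  have A: "fps_nth ?A k = (\<Sum>i\<le>N. ?y ^ i * fps_nth (binom_fps 2 i) k)" if "k \<le> N" for k N
  proof -
    have "fps_nth ?A k = (\<Sum>i\<le>k. ?y ^ i * fps_nth (binom_fps 2 i) k)"
      by (simp add: poly_a_binomial binom_fps_nth mult.commute)
    also have "\<dots> = (\<Sum>i\<le>N. ?y ^ i * fps_nth (binom_fps 2 i) k)"
      using that by (intro sum.mono_neutral_left) (auto simp: binom_fps_nth)
    finally show ?thesis .
  qed
  have "?A * (1 - fps_const ?y * ?U) = binom_fps 2 0"
  proof (rule fps_ext)
    fix k
    have "fps_nth (?U * ?A) k = (\<Sum>j\<le>k. fps_nth ?A j * fps_nth ?U (k - j))"
      by (subst mult.commute) (simp only: fps_mult_nth atLeast0AtMost)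
    also have "\<dots> = (\<Sum>j\<le>k. fps_nth ?U (k - j) * (\<Sum>i\<le>k. ?y ^ i * fps_nth (binom_fps 2 i) j))"
      by (intro sum.cong refl) (simp only: atMost_iff A mult.commute)
    also have "\<dots> = (\<Sum>i\<le>k. ?y ^ i * (\<Sum>j\<le>k. fps_nth (binom_fps 2 i) j * fps_nth ?U (k - j)))"
      unfolding sum_distrib_left by (subst sum.swap) (simp add: mult_ac)
    also have "\<dots> = (\<Sum>i\<le>k. ?y ^ i * fps_nth (binom_fps 2 i * ?U) k)"
      by (simp add: fps_mult_nth atLeast0AtMost)
    also have "\<dots> = (\<Sum>i\<le>k. ?y ^ i * fps_nth (binom_fps 2 (Suc i)) k)"
      by (simp add: binom_fps_shift mult.commute)
    finally have UA: "fps_nth (?U * ?A) k = (\<Sum>i\<le>k. ?y ^ i * fps_nth (binom_fps 2 (Suc i)) k)" .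
    have "?A * (1 - fps_const ?y * ?U) = ?A - fps_const ?y * (?U * ?A)"
      by (simp add: algebra_simps)
    then have "fps_nth (?A * (1 - fps_const ?y * ?U)) k =
        fps_nth ?A k - ?y * fps_nth (?U * ?A) k"
      by (simp only: fps_sub_nth fps_mult_left_const_nth)
    then have "fps_nth (?A * (1 - fps_const ?y * ?U)) k =
        (\<Sum>i\<le>k. ?y ^ i * fps_nth (binom_fps 2 i) k)
        - (\<Sum>i\<le>k. ?y ^ Suc i * fps_nth (binom_fps 2 (Suc i)) k)"
      by (simp only: A[OF order_refl, of k] UA sum_distrib_left power_Suc mult.assoc)
    also have "\<dots> = fps_nth (binom_fps 2 0) k"
      using sum_telescope[of "\<lambda>i. ?y ^ i * fps_nth (binom_fps 2 i) k" k]
      by (simp add: sum_subtractf binom_fps_nth del: power_Suc)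
    finally show "fps_nth (?A * (1 - fps_const ?y * ?U)) k = fps_nth (binom_fps 2 0) k" .
  qed
  then have "?A * (1 - 2 * ?U) * (1 - fps_const ?y * ?U) = (1 - 2 * ?U) * binom_fps 2 0"
    by (metis mult.assoc mult.commute)
  also have "\<dots> = (1 + ?U) ^ 2 * ((1 - 2 * ?U) * binom_fps 0 0)"
    by (simp add: numeral_2_eq_2 binom_fps_add_left mult_ac)
  also have "\<dots> = (1 + ?U) ^ 3"
    by (simp only: central_binom_fps flip: power_Suc2) simp
  finally show ?thesis .
qed

section \<open>Reduction to a linear Hankel pencil\<close>

text \<open>
  One step of a continued fraction of Jacobi type: if \<open>A = 1 / (1 - b X - X M)\<close> as power series
  with \<open>M = \<Sum>l. m l X\<^sup>l\<^sup>+\<^sup>1\<close>, then the Hankel determinant of order \<open>n + 1\<close> of the coefficients of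
  \<open>A\<close> is the one of order \<open>n\<close> of the sequence \<open>m\<close>. Indeed the larger Hankel matrix is
  \<open>L N L\<^sup>T\<close>, where \<open>L\<close> is the unitriangular Toeplitz matrix of the coefficients of \<open>A\<close> and \<open>N\<close> has
  the diagonal blocks \<open>1\<close> and \<open>(m (i + j))\<close>.
\<close>

lemma det_hankel_step:
  fixes s m :: "nat \<Rightarrow> 'a :: idom"
  assumes s0: "s 0 = 1"
    and s_Suc: "\<And>k. s (Suc k) = b * s k + (\<Sum>l<k. m l * s (k - 1 - l))"
  shows "det (mat (Suc n) (Suc n) (\<lambda>(i, j). s (i + j))) = det (mat n n (\<lambda>(i, j). m (i + j)))"
proof -
  \<comment> \<open>\<open>S i j\<close> is the entry of \<open>L N L\<^sup>T\<close>. The recursion for \<open>s\<close> makes \<open>S (Suc i) j\<close> symmetric in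
    \<open>i\<close> and \<open>j\<close>, hence \<open>S\<close> depends only on \<open>i + j\<close>.\<close>
  define S where "S i j = s i * s j + (\<Sum>k<i. \<Sum>l<j. s (i - 1 - k) * m (k + l) * s (j - 1 - l))" for i j
  have S_Suc: "S (Suc i) j = s (Suc i) * s j + s i * s (Suc j) - b * s i * s j
      + (\<Sum>k<i. \<Sum>l<j. s (i - 1 - k) * m (Suc (k + l)) * s (j - 1 - l))" for i j
  proof -
    have "(\<Sum>k<Suc i. \<Sum>l<j. s (i - k) * m (k + l) * s (j - 1 - l)) =
        s i * (\<Sum>l<j. m l * s (j - 1 - l))
        + (\<Sum>k<i. \<Sum>l<j. s (i - 1 - k) * m (Suc (k + l)) * s (j - 1 - l))"
      by (subst sum.lessThan_Suc_shift) (simp add: sum_distrib_left mult.assoc)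
    then show ?thesis
      unfolding S_def by (simp add: s_Suc[of j] algebra_simps)
  qed
  have S_sym: "S i j = S j i" for i j
    unfolding S_def by (subst sum.swap) (simp add: mult_ac add.commute)
  have S_move: "S (Suc i) j = S i (Suc j)" for i j
    unfolding S_sym[of i "Suc j"] S_Suc
    by (subst (2) sum.swap) (simp add: mult_ac add.commute)
  have S: "S i j = s (i + j)" for i j
  proof (induction i arbitrary: j)
    case 0
    then show ?case by (simp add: S_def s0)
  next
    case (Suc i)
    then show ?case by (simp add: S_move)
  qed
  define L where "L = mat (Suc n) (Suc n) (\<lambda>(i, j). if j \<le> i then s (i - j) else 0)"
  define N where "N = mat (Suc n) (Suc n) (\<lambda>(i, j).
    case i of 0 \<Rightarrow> (case j of 0 \<Rightarrow> 1 | Suc _ \<Rightarrow> 0)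
    | Suc k \<Rightarrow> (case j of 0 \<Rightarrow> 0 | Suc l \<Rightarrow> m (k + l)))"
  have L: "L \<in> carrier_mat (Suc n) (Suc n)" and N: "N \<in> carrier_mat (Suc n) (Suc n)"
    by (simp_all add: L_def N_def)
  have "diag_mat L = replicate (Suc n) 1"
    by (intro nth_equalityI) (simp_all add: L_def diag_mat_def s0 del: upt_Suc replicate_Suc)
  then have "det L = 1"
    by (subst det_lower_triangular[OF _ L]) (simp_all add: L_def)
  moreover have "det N = det (mat n n (\<lambda>(i, j). m (i + j)))"
  proof -
    let ?M = "mat n n (\<lambda>(i, j). m (i + j))"
    have "N = four_block_mat (1\<^sub>m 1) (0\<^sub>m 1 n) (0\<^sub>m n 1) ?M"
      by (rule eq_matI) (auto simp: N_def split: nat.splits)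
    then show ?thesis
      by (simp add: det_four_block_mat_lower_left_zero[where n = 1 and m = n])
  qed
  moreover have "L * N * L\<^sup>T = mat (Suc n) (Suc n) (\<lambda>(i, j). s (i + j))"
  proof (rule eq_matI)
    fix i j
    assume "i < dim_row (mat (Suc n) (Suc n) (\<lambda>(i, j). s (i + j)))"
      "j < dim_col (mat (Suc n) (Suc n) (\<lambda>(i, j). s (i + j)))"
    then have ij: "i < Suc n" "j < Suc n" by simp_all
    have cut: "(\<Sum>l<n. if l < j then f l else 0) = (\<Sum>l<j. f l)" if "j < Suc n" for j and f :: "nat \<Rightarrow> 'a"
      using that by (intro sum.mono_neutral_cong_right) auto
    have row: "(\<Sum>l<Suc n. g l * L $$ (j, l)) = g 0 * s j + (\<Sum>l<j. g (Suc l) * s (j - 1 - l))"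
      if "j < Suc n" for j g
    proof -
      have "(\<Sum>l<Suc n. g l * L $$ (j, l)) =
          g 0 * s j + (\<Sum>l<n. if l < j then g (Suc l) * s (j - 1 - l) else 0)"
        using that by (subst sum.lessThan_Suc_shift) (auto simp: L_def intro!: sum.cong)
      then show ?thesis by (simp only: cut[OF that])
    qed
    have "(L * N * L\<^sup>T) $$ (i, j) =
        (\<Sum>k<Suc n. (\<Sum>l<Suc n. N $$ (k, l) * L $$ (j, l)) * L $$ (i, k))"
      using L N ij by (simp add: scalar_prod_def atLeast0LessThan mult.commute del: sum.lessThan_Suc)
    also have "\<dots> = (\<Sum>l<Suc n. N $$ (0, l) * L $$ (j, l)) * s i
        + (\<Sum>k<i. (\<Sum>l<Suc n. N $$ (Suc k, l) * L $$ (j, l)) * s (i - 1 - k))"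
      by (rule row[OF ij(1)])
    also have "\<dots> = s i * s j + (\<Sum>k<i. (\<Sum>l<j. m (k + l) * s (j - 1 - l)) * s (i - 1 - k))"
      using ij by (simp only: row[OF ij(2)]) (simp add: N_def)
    also have "\<dots> = S i j"
      unfolding S_def sum_distrib_right by (simp add: mult_ac)
    finally show "(L * N * L\<^sup>T) $$ (i, j) = mat (Suc n) (Suc n) (\<lambda>(i, j). s (i + j)) $$ (i, j)"
      using ij S by simp
  qed (use L in simp_all)
  moreover have "det (L * N * L\<^sup>T) = det L * det N * det L"
    using L N by (simp add: det_mult[of _ "Suc n"] det_transpose)
  ultimately show ?thesis by simp
qed

text \<open>
  The coefficient of \<open>X\<^sup>k\<close> in \<open>U\<^sup>p\<close>.
\<close>

definition power_coeff :: "nat \<Rightarrow> nat \<Rightarrow> real" where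
  "power_coeff p k = fps_nth (ternary_fps ^ p) k"

text \<open>
  The Hankel matrix of the series \<open>(3 - 2y) U + U\<^sup>2\<close>, starting with the coefficient of \<open>X\<close>. It is
  linear in the parameter \<open>y\<close>, and the coefficient of \<open>-2y\<close> is \<open>ternary_hankel n\<close>.
\<close>

definition hankel_pencil :: "nat \<Rightarrow> real \<Rightarrow> real mat" where
  "hankel_pencil n y = mat n n (\<lambda>(i, j).
     (3 - 2 * y) * power_coeff 1 (Suc (i + j)) + power_coeff 2 (Suc (i + j)))"

text \<open>
  The Hankel matrix of \<open>U\<close>, starting with the coefficient of \<open>X\<close>.
\<close>

definition ternary_hankel :: "nat \<Rightarrow> real mat" where
  "ternary_hankel n = mat n n (\<lambda>(i, j). power_coeff 1 (Suc (i + j)))"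

lemma det_hankel_step_fps:
  fixes A M :: "real fps"
  assumes A: "A = 1 + fps_X * (fps_const b * A + M * A)" and M0: "fps_nth M 0 = 0"
  shows "det (mat (Suc n) (Suc n) (\<lambda>(i, j). fps_nth A (i + j))) =
    det (mat n n (\<lambda>(i, j). fps_nth M (Suc (i + j))))"
proof (rule det_hankel_step)
  show "fps_nth A 0 = 1"
    by (subst A) simp
  show "fps_nth A (Suc k) = b * fps_nth A k + (\<Sum>l<k. fps_nth M (Suc l) * fps_nth A (k - 1 - l))" for k
  proof -
    have "fps_nth A (Suc k) = b * fps_nth A k + fps_nth (M * A) k"
      by (subst A) simp
    also have "fps_nth (M * A) k = (\<Sum>l<Suc k. fps_nth M l * fps_nth A (k - l))"
      by (simp only: fps_mult_nth atLeast0AtMost lessThan_Suc_atMost)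
    also have "\<dots> = (\<Sum>l<k. fps_nth M (Suc l) * fps_nth A (k - 1 - l))"
      by (subst sum.lessThan_Suc_shift) (simp add: M0)
    finally show ?thesis .
  qed
qed

text \<open>
  For \<open>A = \<Sum>k. a k X\<^sup>k\<close> and \<open>y = x - 1\<close>, the closed form of \<open>A\<close> is equivalent to
  \<open>1 / A = 1 - (5 + y) X - X ((3 - 2y) U + U\<^sup>2)\<close>; this is where the determinant becomes one of a
  linear pencil.
\<close>

lemma det_a_hankel:
  "det (mat (Suc n) (Suc n) (\<lambda>(i, j). poly (a (i + j)) x)) = det (hankel_pencil n (x - 1))"
proof -
  let ?U = ternary_fps and ?A = "Abs_fps (\<lambda>k. poly (a k) x)"
  define Y where "Y = fps_const (x - 1)"
  define M where "M = (3 - 2 * Y) * ?U + ?U ^ 2"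
  have "(1 + ?U) ^ 3 * ?A = (1 + ?U) ^ 3 + ?U * ((5 + Y) * ?A + M * ?A)"
  proof -
    have "(1 + ?U) ^ 3 * ?A = ?A * (1 - 2 * ?U) * (1 - Y * ?U) + ?U * ((5 + Y) * ?A + M * ?A)"
      unfolding M_def by (simp add: algebra_simps power2_eq_square power3_eq_cube)
    then show ?thesis
      by (simp only: a_fps[of x, folded Y_def])
  qed
  also have "\<dots> = (1 + ?U) ^ 3 * (1 + fps_X * ((5 + Y) * ?A + M * ?A))"
    by (subst (2) ternary_fps_eq) (simp add: distrib_left mult_ac)
  finally have "?A = 1 + fps_X * ((5 + Y) * ?A + M * ?A)"
    using one_plus_ternary_nonzero by simp
  also have "5 + Y = fps_const (5 + (x - 1))"
    by (simp only: Y_def numeral_fps_const fps_const_add)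
  finally have "det (mat (Suc n) (Suc n) (\<lambda>(i, j). fps_nth ?A (i + j))) =
      det (mat n n (\<lambda>(i, j). fps_nth M (Suc (i + j))))"
    by (rule det_hankel_step_fps) (simp add: M_def)
  moreover have "fps_nth M k = (3 - 2 * (x - 1)) * power_coeff 1 k + power_coeff 2 k" for k
  proof -
    have "M = fps_const (3 - 2 * (x - 1)) * ?U + ?U ^ 2"
      by (simp add: M_def Y_def numeral_fps_const)
    then show ?thesis by (simp add: power_coeff_def)
  qed
  ultimately show ?thesis
    by (simp add: hankel_pencil_def)
qed

text \<open>
  The same step for \<open>U / X = (1 + U)\<^sup>3\<close>, whose reciprocal is \<open>1 - 3X - X (3U + U\<^sup>2)\<close>.
\<close>

lemma det_ternary_hankel_Suc: "det (ternary_hankel (Suc n)) = det (hankel_pencil n 0)"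
proof -
  let ?U = ternary_fps
  define T where "T = (1 + ?U) ^ 3"
  define M where "M = 3 * ?U + ?U ^ 2"
  have U: "?U = fps_X * T"
    unfolding T_def by (rule ternary_fps_eq)
  have "T = 1 + ?U * (3 + M)"
    by (simp add: T_def M_def algebra_simps power2_eq_square power3_eq_cube)
  also have "\<dots> = 1 + fps_X * (fps_const 3 * T + M * T)"
    by (subst U) (simp add: numeral_fps_const algebra_simps)
  finally have "det (mat (Suc n) (Suc n) (\<lambda>(i, j). fps_nth T (i + j))) =
      det (mat n n (\<lambda>(i, j). fps_nth M (Suc (i + j))))"
    by (rule det_hankel_step_fps) (simp add: M_def)
  moreover have "fps_nth T k = power_coeff 1 (Suc k)" for k
    unfolding power_coeff_def power_one_right by (subst U) simp
  moreover have "fps_nth M k = 3 * power_coeff 1 k + power_coeff 2 k" for k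
    by (simp add: M_def power_coeff_def numeral_fps_const)
  ultimately show ?thesis
    by (simp add: hankel_pencil_def ternary_hankel_def)
qed

section \<open>Powers of the ternary tree series\<close>

lemma power_coeff_0: "0 < k \<Longrightarrow> power_coeff 0 k = 0"
  by (simp add: power_coeff_def)

lemma power_coeff_eq_0: "k < p \<Longrightarrow> power_coeff p k = 0"
  unfolding power_coeff_def using startsby_zero_power_prefix[OF ternary_fps_nth_0] by blast

lemma power_coeff_diag: "power_coeff p p = 1"
proof -
  have "ternary_fps ^ p = fps_X ^ p * ((1 + ternary_fps) ^ 3) ^ p"
    by (metis ternary_fps_eq power_mult_distrib)
  then show ?thesis
    by (simp add: power_coeff_def fps_X_power_mult_nth fps_power_zeroth)
qed

lemma power_coeff_rec:
  "power_coeff (Suc p) (Suc k) = power_coeff p k + 3 * power_coeff (Suc p) k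
     + 3 * power_coeff (Suc (Suc p)) k + power_coeff (Suc (Suc (Suc p))) k"
proof -
  let ?U = ternary_fps
  have "?U ^ Suc p = fps_X * (1 + ?U) ^ 3 * ?U ^ p"
    by (metis ternary_fps_eq power_Suc)
  also have "\<dots> = fps_X * (?U ^ p + 3 * ?U ^ Suc p + 3 * ?U ^ Suc (Suc p) + ?U ^ Suc (Suc (Suc p)))"
    by (simp add: algebra_simps power3_eq_cube)
  finally have eq: "?U ^ Suc p = \<dots>" .
  have "fps_nth (?U ^ Suc p) (Suc k) =
      fps_nth (?U ^ p + 3 * ?U ^ Suc p + 3 * ?U ^ Suc (Suc p) + ?U ^ Suc (Suc (Suc p))) k"
    by (subst eq) (simp only: fps_X_mult_nth nat.distinct if_False diff_Suc_1)
  moreover have "fps_nth (3 * F) k = 3 * fps_nth F k" for F :: "real fps"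
    by (simp add: numeral_fps_const)
  ultimately show ?thesis
    unfolding power_coeff_def by (simp del: power_Suc)
qed

text \<open>
  Up to sign, \<open>shifted_binom p l\<close> is the coefficient of \<open>s\<^sup>l\<close> in the polynomial \<open>c\<^sub>p(s)\<close> given by
  \<open>\<Sum>p. c\<^sub>p(s) W\<^sup>p = W / ((1 + W)\<^sup>3 - s W\<^sup>2)\<close>.
\<close>

definition shifted_binom :: "nat \<Rightarrow> nat \<Rightarrow> real" where
  "shifted_binom p l = real ((p + l + 1) choose (3 * l + 2))"

text \<open>
  The coefficient of \<open>s\<^sup>l\<close> in \<open>c\<^sub>p(s)\<close>. With \<open>s = 1 / X\<close>, the cubic relation
  \<open>s U = (1 + U)\<^sup>3\<close> reduces every power of \<open>U\<close> to
  \<open>U\<^sup>p\<^sup>+\<^sup>1 = Q\<^sub>p(s) - c\<^sub>p(s) / U + c\<^sub>p\<^sub>+\<^sub>1(s) U\<close> with a polynomial \<open>Q\<^sub>p\<close>.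
\<close>

definition expand_coeff :: "nat \<Rightarrow> nat \<Rightarrow> real" where
  "expand_coeff p l = (-1) ^ Suc p * shifted_binom p l"

lemma expand_coeff_eq_0: "p \<le> 2 * l \<Longrightarrow> expand_coeff p l = 0"
  by (simp add: expand_coeff_def shifted_binom_def del: binomial_Suc_Suc)

text \<open>
  The denominator \<open>(1 + W)\<^sup>3 - s W\<^sup>2\<close> as a recursion in \<open>p\<close>.
\<close>

lemma expand_coeff_rec:
  "expand_coeff (Suc (Suc (Suc p))) l =
    (case l of 0 \<Rightarrow> 0 | Suc l' \<Rightarrow> expand_coeff (Suc p) l')
    - 3 * expand_coeff (Suc (Suc p)) l - 3 * expand_coeff (Suc p) l - expand_coeff p l"
proof (cases l)
  case 0
  then show ?thesis
    by (simp add: expand_coeff_def shifted_binom_def numeral_2_eq_2 algebra_simps)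
next
  case (Suc j)
  define q r where "q = p + j + 2" and "r = 3 * j + 2"
  have third_difference: "real (Suc (Suc (Suc q)) choose Suc (Suc (Suc r)))
      - 3 * real (Suc (Suc q) choose Suc (Suc (Suc r)))
      + 3 * real (Suc q choose Suc (Suc (Suc r))) - real (q choose Suc (Suc (Suc r)))
      = real (q choose r)"
    by simp
  have "p + l + 1 = q" "Suc p + l + 1 = Suc q" "Suc (Suc p) + l + 1 = Suc (Suc q)"
    "Suc (Suc (Suc p)) + l + 1 = Suc (Suc (Suc q))" "3 * l + 2 = Suc (Suc (Suc r))"
    "Suc p + j + 1 = q" "3 * j + 2 = r"
    using Suc by (simp_all add: q_def r_def)
  then have
    "expand_coeff (Suc (Suc (Suc p))) l = (-1) ^ p * real (Suc (Suc (Suc q)) choose Suc (Suc (Suc r)))"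
    "expand_coeff (Suc (Suc p)) l = - ((-1) ^ p * real (Suc (Suc q) choose Suc (Suc (Suc r))))"
    "expand_coeff (Suc p) l = (-1) ^ p * real (Suc q choose Suc (Suc (Suc r)))"
    "expand_coeff p l = - ((-1) ^ p * real (q choose Suc (Suc (Suc r))))"
    "expand_coeff (Suc p) j = (-1) ^ p * real (q choose r)"
    by (simp_all only: expand_coeff_def shifted_binom_def) simp_all
  then show ?thesis
    unfolding third_difference[symmetric] by (simp only: Suc nat.case) (simp only: algebra_simps)
qed

lemma sum_expand_coeff_rec:
  fixes w :: "nat \<Rightarrow> real"
  assumes "p + 3 \<le> 2 * N"
  shows "(\<Sum>l<N. expand_coeff (Suc (Suc (Suc p))) l * w (k + l)) =
    (\<Sum>l<N. expand_coeff (Suc p) l * w (Suc k + l))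
    - 3 * (\<Sum>l<N. expand_coeff (Suc (Suc p)) l * w (k + l))
    - 3 * (\<Sum>l<N. expand_coeff (Suc p) l * w (k + l))
    - (\<Sum>l<N. expand_coeff p l * w (k + l))"
proof -
  obtain M where N: "N = Suc M"
    using assms by (cases N) auto
  have "expand_coeff (Suc p) M = 0"
    using assms by (intro expand_coeff_eq_0) (simp add: N)
  then have "(\<Sum>l<N. expand_coeff (Suc p) l * w (Suc k + l)) =
      (\<Sum>l<N. (case l of 0 \<Rightarrow> 0 | Suc l' \<Rightarrow> expand_coeff (Suc p) l') * w (k + l))"
    unfolding N sum.lessThan_Suc[of "\<lambda>l. expand_coeff (Suc p) l * w (Suc k + l)"]
    by (subst sum.lessThan_Suc_shift) simp
  then show ?thesis
    unfolding sum_distrib_left sum_subtractf[symmetric]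
    by (simp add: expand_coeff_rec left_diff_distrib sum_subtractf mult.assoc)
qed

text \<open>
  The coefficient of \<open>X\<^sup>k\<close> for \<open>k > 0\<close> in the reduction of \<open>U\<^sup>p\<^sup>+\<^sup>1\<close>: multiplication by \<open>s\<^sup>l\<close> shifts
  the index by \<open>l\<close>, the polynomial \<open>Q\<^sub>p\<close> does not contribute, and \<open>1 / U = s - 3 - 3U - U\<^sup>2\<close>. The bound on
  \<open>p\<close> ensures that the sums over \<open>l < N\<close> contain all nonzero coefficients.
\<close>

lemma power_coeff_expand:
  assumes "p < 2 * N" "0 < k"
  shows "power_coeff (Suc p) k =
    (\<Sum>l<N. expand_coeff p l * (3 * power_coeff 1 (k + l) + power_coeff 2 (k + l)))
    + (\<Sum>l<N. expand_coeff (Suc p) l * power_coeff 1 (k + l))"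
  using assms
proof (induction p arbitrary: k rule: less_induct)
  case (less p)
  have single: "(\<Sum>l<N. expand_coeff q l * w l) = expand_coeff q 0 * w 0"
    if "q \<le> 2" for q and w :: "nat \<Rightarrow> real"
  proof -
    have "(\<Sum>l<N. expand_coeff q l * w l) = (\<Sum>l\<in>{0}. expand_coeff q l * w l)"
      using that less.prems by (intro sum.mono_neutral_right) (auto intro!: expand_coeff_eq_0)
    then show ?thesis by simp
  qed
  consider "p = 0" | "p = 1" | "p = 2" | q where "p = Suc (Suc (Suc q))"
    by (metis One_nat_def Suc_1 not0_implies_Suc)
  then show ?case
  proof cases
    case 1
    then show ?thesis
      by (simp add: single) (simp add: expand_coeff_def shifted_binom_def)
  next
    case 2
    then show ?thesis
      by (simp add: single numeral_2_eq_2) (simp add: expand_coeff_def shifted_binom_def numeral_3_eq_3 numeral_2_eq_2)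
  next
    case 3
    \<comment> \<open>\<open>c\<^sub>2 = -3\<close> and \<open>c\<^sub>3 = s + 6\<close>; the linear term brings in the coefficient at \<open>Suc k\<close>.\<close>
    have "{..<N} = insert 0 (insert 1 {2..<N})"
      using less.prems 3 by auto
    moreover have "(\<Sum>l\<in>{2..<N}. expand_coeff 3 l * power_coeff 1 (k + l)) = 0"
      by (intro sum.neutral) (auto intro!: expand_coeff_eq_0)
    ultimately have "(\<Sum>l<N. expand_coeff 3 l * power_coeff 1 (k + l)) =
        expand_coeff 3 0 * power_coeff 1 k + expand_coeff 3 1 * power_coeff 1 (Suc k)"
      by simp
    moreover have "expand_coeff 2 0 = - 3" "expand_coeff 3 0 = 6" "expand_coeff 3 1 = 1"
      by (simp_all add: expand_coeff_def shifted_binom_def eval_nat_numeral)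
    ultimately show ?thesis
      using 3 less.prems power_coeff_rec[of 0 k]
      by (simp add: single power_coeff_0 numeral_2_eq_2 numeral_3_eq_3)
  next
    case 4
    let ?e = "power_coeff 1" and ?f = "\<lambda>k. 3 * power_coeff 1 k + power_coeff 2 k"
    have q: "Suc q + 3 \<le> 2 * N" "q + 3 \<le> 2 * N"
      using less.prems 4 by simp_all
    have "power_coeff (Suc p) k = power_coeff (Suc (Suc q)) (Suc k) - power_coeff (Suc q) k
        - 3 * power_coeff (Suc (Suc q)) k - 3 * power_coeff (Suc (Suc (Suc q))) k"
      using power_coeff_rec[of "Suc q" k] 4 by simp
    then show ?thesis
      using less.IH[of q k] less.IH[of "Suc q" k] less.IH[of "Suc (Suc q)" k]
        less.IH[of "Suc q" "Suc k"] less.prems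
        sum_expand_coeff_rec[OF q(1), of ?e k] sum_expand_coeff_rec[OF q(2), of ?f k]
      unfolding 4 by simp
  qed
qed

section \<open>A vanishing hypergeometric sum\<close>

text \<open>
  The coefficients of the hypergeometric polynomial
  \<open>\<^sub>2F\<^sub>1(-n, 3n + 3; 2n + 5/2; t / 4)\<close> in \<open>t\<close>.
\<close>

fun hyp_coeff :: "nat \<Rightarrow> nat \<Rightarrow> real" where
  "hyp_coeff n 0 = 1"
| "hyp_coeff n (Suc m) = hyp_coeff n m * ((real m - real n) * (real m + 3 * real n + 3))
     / (2 * (real m + 1) * (2 * real m + 4 * real n + 5))"

declare hyp_coeff.simps(2) [simp del]

lemma hyp_coeff_rec:
  "hyp_coeff n (Suc m) * (2 * (real m + 1) * (2 * real m + 4 * real n + 5)) =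
    hyp_coeff n m * ((real m - real n) * (real m + 3 * real n + 3))"
proof -
  have "2 * (real m + 1) * (2 * real m + 4 * real n + 5) \<noteq> 0"
    by (smt (verit) mult_pos_pos of_nat_0_le_iff)
  then show ?thesis by (simp add: hyp_coeff.simps(2))
qed

lemma hyp_coeff_nonzero: "m \<le> n \<Longrightarrow> hyp_coeff n m \<noteq> 0"
proof (induction m)
  case (Suc m)
  then have "real m - real n \<noteq> 0" "real m + 3 * real n + 3 \<noteq> 0"
    "2 * (real m + 1) \<noteq> 0" "2 * real m + 4 * real n + 5 \<noteq> 0"
    by (simp_all add: add_nonneg_eq_0_iff)
  with Suc show ?case by (simp add: hyp_coeff.simps(2))
qed simp

text \<open>
  The summand-wise identity behind the recursion of the sums below in \<open>i\<close>: after multiplication by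
  \<open>hyp_coeff n m\<close> the left-hand side is a difference of consecutive values of one function of \<open>m\<close>.
\<close>

lemma binomial_certificate:
  fixes n m i :: nat
  defines "q \<equiv> n + i + 1 + m"
  shows "(real m - real n) * (real m + 3 * real n + 3) * real (Suc q choose (3 * i + 3))
      - 2 * real m * (2 * real m + 4 * real n + 3) * real (q choose (3 * i + 3))
    = (2 * real i - 2 * real n + 1) * (2 * real i + 2 * real n + 4) * real (q choose (3 * i + 2))
      - 3 * (3 * real i + 4) * (3 * real i + 5) * real (Suc q choose (3 * i + 5))"
proof -
  \<comment> \<open>Everything is a rational multiple of \<open>x = (q choose r)\<close>; \<open>real r + 1\<close> clears denominators.\<close>
  define r where "r = 3 * i + 2"
  have r: "3 * i + 2 = r" "3 * i + 3 = Suc r" "3 * i + 5 = Suc (Suc (Suc r))"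
    by (simp_all add: r_def)
  have up: "real (Suc l) * real (Suc k choose Suc l) = real (Suc k) * real (k choose l)" for k l
    by (metis Suc_times_binomial of_nat_mult)
  have right: "real (Suc l) * real (k choose Suc l) = (real k - real l) * real (k choose l)" for k l
    using up[of l k] by (simp add: algebra_simps)
  define x where "x = real (q choose r)"
  have 1: "(real r + 1) * real (Suc q choose Suc r) = (real q + 1) * x"
    using up[of r q] by (simp add: x_def add.commute del: binomial_Suc_Suc)
  have 2: "(real r + 1) * real (q choose Suc r) = (real q - real r) * x"
    using right[of r q] by (simp add: x_def add.commute)
  have 3: "(real r + 1) * ((real r + 2) * (real r + 3) * real (Suc q choose Suc (Suc (Suc r)))) =
      (real q + 1) * (real q - real r) * (real q - real r - 1) * x"
  proof -
    have s3: "(real r + 3) * real (Suc q choose Suc (Suc (Suc r))) =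
        (real q + 1) * real (q choose Suc (Suc r))"
      using up[of "Suc (Suc r)" q] by (simp add: add.commute del: binomial_Suc_Suc)
    have s2: "(real r + 2) * real (q choose Suc (Suc r)) =
        (real q - real r - 1) * real (q choose Suc r)"
      using right[of "Suc r" q] by (simp add: algebra_simps)
    have "(real r + 1) * ((real r + 2) * (real r + 3) * real (Suc q choose Suc (Suc (Suc r)))) =
        (real r + 1) * (real r + 2) * ((real r + 3) * real (Suc q choose Suc (Suc (Suc r))))"
      by (simp only: mult_ac)
    also have "\<dots> = (real r + 1) * (real q + 1) * ((real r + 2) * real (q choose Suc (Suc r)))"
      by (subst s3) (simp only: mult_ac)
    also have "\<dots> = (real q + 1) * (real q - real r - 1) * ((real r + 1) * real (q choose Suc r))"
      by (subst s2) (simp only: mult_ac)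
    also have "\<dots> = (real q + 1) * (real q - real r) * (real q - real r - 1) * x"
      by (subst 2) (simp only: mult_ac)
    finally show ?thesis .
  qed
  have q: "real q = real n + real i + 1 + real m" and rr: "real r = 3 * real i + 2"
    by (simp_all add: q_def r_def)
  let ?a = "(real m - real n) * (real m + 3 * real n + 3)"
    and ?b = "2 * real m * (2 * real m + 4 * real n + 3)"
    and ?c = "(2 * real i - 2 * real n + 1) * (2 * real i + 2 * real n + 4)"
  have "(real r + 1) * (?a * real (Suc q choose Suc r) - ?b * real (q choose Suc r))
      = ?a * ((real q + 1) * x) - ?b * ((real q - real r) * x)"
    unfolding 1[symmetric] 2[symmetric] by (simp only: algebra_simps)
  also have "\<dots> = ?c * (real r + 1) * x
      - 3 * ((real q + 1) * (real q - real r) * (real q - real r - 1) * x)"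
    unfolding q rr by (simp add: algebra_simps)
  also have "\<dots> = (real r + 1) * (?c * x
      - 3 * (3 * real i + 4) * (3 * real i + 5) * real (Suc q choose Suc (Suc (Suc r))))"
  proof -
    have "real r + 2 = 3 * real i + 4" "real r + 3 = 3 * real i + 5"
      by (simp_all add: rr)
    from 3[unfolded this] show ?thesis
      by (subst (asm) eq_commute) (simp add: algebra_simps del: binomial_Suc_Suc)
  qed
  finally show ?thesis
    unfolding r x_def[symmetric] by (simp del: binomial_Suc_Suc add: rr)
qed

text \<open>
  A vanishing \<open>\<^sub>3F\<^sub>2\<close> sum at \<open>1/4\<close>. The sums for \<open>i\<close> and \<open>i + 1\<close> are proportional, and the
  sum for \<open>i = n\<close> has only zero terms, so vanishing propagates downwards from \<open>n\<close>; the factor of the sum for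
  \<open>i\<close> is nonzero since \<open>2i + 1 \<noteq> 2n\<close>.
\<close>

lemma hyp_coeff_orthogonal:
  assumes "i < n"
  shows "(\<Sum>m\<le>n. hyp_coeff n m * real ((n + m + i + 1) choose (3 * i + 2))) = 0"
proof -
  define S where "S i = (\<Sum>m\<le>n. hyp_coeff n m * real ((n + m + i + 1) choose (3 * i + 2)))" for i
  have rec: "(2 * real i - 2 * real n + 1) * (2 * real i + 2 * real n + 4) * S i =
      3 * (3 * real i + 4) * (3 * real i + 5) * S (Suc i)" (is "?c * S i = ?d * S (Suc i)") for i
  proof -
    define T where "T m = hyp_coeff n m * (2 * real m * (2 * real m + 4 * real n + 3))
      * real ((n + i + 1 + m) choose (3 * i + 3))" for m
    have "?c * S i - ?d * S (Suc i) = (\<Sum>m\<le>n. T (Suc m) - T m)"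
      unfolding S_def sum_distrib_left sum_subtractf[symmetric]
    proof (intro sum.cong refl)
      fix m
      have e: "n + m + i + 1 = n + i + 1 + m" "n + m + Suc i + 1 = Suc (n + i + 1 + m)"
        "3 * Suc i + 2 = 3 * i + 5" "n + i + 1 + Suc m = Suc (n + i + 1 + m)"
        by simp_all
      have "T (Suc m) = hyp_coeff n (Suc m) * (2 * (real m + 1) * (2 * real m + 4 * real n + 5))
          * real (Suc (n + i + 1 + m) choose (3 * i + 3))"
        unfolding T_def e by (simp add: algebra_simps del: binomial_Suc_Suc)
      also have "\<dots> = hyp_coeff n m * ((real m - real n) * (real m + 3 * real n + 3)
          * real (Suc (n + i + 1 + m) choose (3 * i + 3)))"
        unfolding hyp_coeff_rec by (simp only: mult.assoc)
      finally have "T (Suc m) - T m = hyp_coeff n m *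
          ((real m - real n) * (real m + 3 * real n + 3) * real (Suc (n + i + 1 + m) choose (3 * i + 3))
          - 2 * real m * (2 * real m + 4 * real n + 3) * real ((n + i + 1 + m) choose (3 * i + 3)))"
        by (simp only: T_def right_diff_distrib mult.assoc)
      also have "\<dots> = ?c * (hyp_coeff n m * real ((n + m + i + 1) choose (3 * i + 2)))
          - ?d * (hyp_coeff n m * real ((n + m + Suc i + 1) choose (3 * Suc i + 2)))"
        unfolding binomial_certificate e by (simp only: right_diff_distrib mult_ac)
      finally show "?c * (hyp_coeff n m * real ((n + m + i + 1) choose (3 * i + 2)))
          - ?d * (hyp_coeff n m * real ((n + m + Suc i + 1) choose (3 * Suc i + 2)))
        = T (Suc m) - T m" by simp
    qed
    also have "\<dots> = T (Suc n) - T 0"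
      using sum_telescope[of T n] by (simp add: sum_subtractf)
    also have "\<dots> = 0"
      by (simp add: T_def hyp_coeff.simps(2))
    finally show ?thesis by simp
  qed
  have "i \<le> n \<Longrightarrow> S i = 0" for i
  proof (induction i rule: inc_induct)
    case base
    show ?case
      unfolding S_def by (intro sum.neutral ballI) (simp del: binomial_Suc_Suc)
  next
    case (step i)
    have "2 * real i - 2 * real n + 1 \<noteq> 0"
    proof
      assume "2 * real i - 2 * real n + 1 = 0"
      then have "real (2 * i + 1) = real (2 * n)" by simp
      then have "2 * i + 1 = 2 * n" by (rule of_nat_eq_iff[THEN iffD1])
      then show False by presburger
    qed
    moreover have "2 * real i + 2 * real n + 4 \<noteq> 0"
      by (smt (verit) of_nat_0_le_iff)
    ultimately show ?case
      using rec[of i] step.IH by simp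
  qed
  then show ?thesis
    using assms by (simp add: S_def)
qed

section \<open>The determinant of the pencil\<close>

text \<open>
  Column \<open>m\<close> holds, up to sign, the coefficients of \<open>c\<^sub>n\<^sub>+\<^sub>m\<close>, which has degree less than \<open>n\<close> for
  \<open>m < n\<close>.
\<close>

definition binom_mat :: "nat \<Rightarrow> real mat" where
  "binom_mat n = mat n n (\<lambda>(l, m). shifted_binom (n + m) l)"

text \<open>
  A linear relation \<open>\<Sum>m. w\<^sub>m c\<^sub>n\<^sub>+\<^sub>m = 0\<close> turns the reduction of the powers of \<open>U\<close> into
  \<open>\<Sum>m. w\<^sub>m U\<^sup>n\<^sup>+\<^sup>m\<^sup>+\<^sup>1 = Q(s) + u(s) U\<close> with \<open>u = \<Sum>m. w\<^sub>m c\<^sub>n\<^sub>+\<^sub>m\<^sub>+\<^sub>1\<close>. The coefficients of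
  \<open>X, \<dots>, X\<^sup>n\<close> vanish on the left, so the coefficient vector of \<open>u\<close> lies in the kernel of
  \<open>ternary_hankel n\<close>.
\<close>

lemma det_binom_mat_nonzero:
  assumes B: "det (ternary_hankel n) \<noteq> 0"
  shows "det (binom_mat n) \<noteq> 0"
proof
  assume "det (binom_mat n) = 0"
  moreover have "binom_mat n \<in> carrier_mat n n"
    by (simp add: binom_mat_def)
  ultimately obtain v where v: "v \<in> carrier_vec n" "v \<noteq> 0\<^sub>v n"
    and Xv: "binom_mat n *\<^sub>v v = 0\<^sub>v n"
    using det_0_iff_vec_prod_zero_field by blast
  define w where "w m = (-1) ^ Suc (n + m) * v $ m" for m
  have ker: "(\<Sum>m<n. expand_coeff (n + m) l * w m) = 0" if "l < n" for l
  proof -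
    have "(\<Sum>m<n. shifted_binom (n + m) l * v $ m) = 0"
      using arg_cong[OF Xv, of "\<lambda>w. w $ l"] that v
      by (simp add: binom_mat_def scalar_prod_def atLeast0LessThan)
    moreover have "expand_coeff (n + m) l * w m = shifted_binom (n + m) l * v $ m" for m
    proof -
      have "(-1) ^ Suc (n + m) * (-1) ^ Suc (n + m) = (1 :: real)"
        by (simp flip: power_mult_distrib)
      then show ?thesis
        unfolding expand_coeff_def w_def by (metis mult.assoc mult.left_commute mult_1)
    qed
    ultimately show ?thesis by simp
  qed
  define u where "u = vec n (\<lambda>l. \<Sum>m<n. expand_coeff (Suc (n + m)) l * w m)"
  have expand: "(\<Sum>m<n. power_coeff (Suc (n + m)) k * w m) = (\<Sum>l<n. power_coeff 1 (k + l) * u $ l)"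
    if "0 < k" for k
  proof -
    let ?f = "\<lambda>k. 3 * power_coeff 1 k + power_coeff 2 k"
    have "(\<Sum>m<n. power_coeff (Suc (n + m)) k * w m) =
        (\<Sum>m<n. \<Sum>l<n. expand_coeff (n + m) l * ?f (k + l) * w m)
        + (\<Sum>m<n. \<Sum>l<n. expand_coeff (Suc (n + m)) l * power_coeff 1 (k + l) * w m)"
      unfolding sum.distrib[symmetric]
      using power_coeff_expand[OF _ that, of _ n]
      by (intro sum.cong refl) (simp add: distrib_right sum_distrib_right sum.distrib)
    also have "(\<Sum>m<n. \<Sum>l<n. expand_coeff (n + m) l * ?f (k + l) * w m) =
        (\<Sum>l<n. ?f (k + l) * (\<Sum>m<n. expand_coeff (n + m) l * w m))"
      unfolding sum_distrib_left by (subst sum.swap) (simp only: mult_ac)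
    also have "\<dots> = 0"
      by (intro sum.neutral) (simp add: ker)
    also have "(\<Sum>m<n. \<Sum>l<n. expand_coeff (Suc (n + m)) l * power_coeff 1 (k + l) * w m) =
        (\<Sum>l<n. power_coeff 1 (k + l) * (\<Sum>m<n. expand_coeff (Suc (n + m)) l * w m))"
      unfolding sum_distrib_left by (subst sum.swap) (simp only: mult_ac)
    finally show ?thesis by (simp add: u_def)
  qed
  have "ternary_hankel n *\<^sub>v u = 0\<^sub>v n"
  proof (rule eq_vecI)
    fix i
    assume "i < dim_vec (0\<^sub>v n :: real vec)"
    then have i: "i < n" by simp
    have "(ternary_hankel n *\<^sub>v u) $ i = (\<Sum>l<n. power_coeff 1 (Suc i + l) * u $ l)"
      using i by (simp add: ternary_hankel_def scalar_prod_def u_def atLeast0LessThan)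
    also have "\<dots> = (\<Sum>m<n. power_coeff (Suc (n + m)) (Suc i) * w m)"
      by (rule expand[symmetric]) simp
    also have "\<dots> = 0"
      using i by (intro sum.neutral) (simp add: power_coeff_eq_0)
    finally show "(ternary_hankel n *\<^sub>v u) $ i = 0\<^sub>v n $ i"
      using i by simp
  qed (simp add: ternary_hankel_def)
  moreover have "ternary_hankel n \<in> carrier_mat n n" "u \<in> carrier_vec n"
    by (simp_all add: ternary_hankel_def u_def)
  ultimately have u0: "u = 0\<^sub>v n"
    using B det_0_iff_vec_prod_zero_field by blast
  have "m < n \<Longrightarrow> w m = 0" for m
  proof (induction m rule: less_induct)
    case (less m)
    have "0 = (\<Sum>j<n. power_coeff (Suc (n + j)) (Suc (n + m)) * w j)"
      using expand[of "Suc (n + m)"] by (simp add: u0)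
    also have "\<dots> = (\<Sum>j\<in>{m}. power_coeff (Suc (n + j)) (Suc (n + m)) * w j)"
    proof (intro sum.mono_neutral_right ballI)
      fix j
      assume "j \<in> {..<n} - {m}"
      then consider "j < m" "j < n" | "m < j"
        by fastforce
      then show "power_coeff (Suc (n + j)) (Suc (n + m)) * w j = 0"
        by cases (simp_all add: less.IH power_coeff_eq_0)
    qed (use less.prems in auto)
    finally show ?case by (simp add: power_coeff_diag)
  qed
  then have "v $ m = 0" if "m < n" for m
    using that by (simp add: w_def)
  then have "v = 0\<^sub>v n"
    using v(1) by (intro eq_vecI) auto
  with v(2) show False by simp
qed

text \<open>
  The intermediate values of Horner's scheme for \<open>\<Sum>m\<le>n. hyp_coeff n m * t ^ m\<close>; the value of the
  polynomial itself is \<open>hyp_tail n t 0\<close>.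
\<close>

definition hyp_tail :: "nat \<Rightarrow> real \<Rightarrow> nat \<Rightarrow> real" where
  "hyp_tail n t m = (\<Sum>j<Suc n - m. hyp_coeff n (m + j) * t ^ j)"

lemma hyp_tail_rec: "m \<le> n \<Longrightarrow> hyp_tail n t m = hyp_coeff n m + t * hyp_tail n t (Suc m)"
  unfolding hyp_tail_def
  by (simp add: Suc_diff_le sum.lessThan_Suc_shift sum_distrib_left mult_ac del: sum.lessThan_Suc)

text \<open>
  Division of \<open>p(T) - p(t)\<close> by \<open>T - t\<close> for the polynomial \<open>p\<close> with coefficients \<open>hyp_coeff n\<close>,
  where \<open>T\<^sup>m\<close> is replaced by \<open>v m\<close>.
\<close>

lemma sum_hyp_tail:
  fixes v :: "nat \<Rightarrow> real"
  assumes "(\<Sum>m\<le>n. hyp_coeff n m * v m) = 0"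
  shows "(\<Sum>m<n. hyp_tail n t (Suc m) * (v (Suc m) - t * v m)) = - hyp_tail n t 0 * v 0"
proof -
  have "(\<Sum>m<n. hyp_tail n t (Suc m) * (v (Suc m) - t * v m)) =
      (\<Sum>m<n. (hyp_tail n t (Suc m) * v (Suc m) - hyp_tail n t m * v m) + hyp_coeff n m * v m)"
    by (intro sum.cong refl) (simp add: hyp_tail_rec[of _ n] algebra_simps)
  also have "\<dots> = (hyp_tail n t n * v n - hyp_tail n t 0 * v 0) + (\<Sum>m<n. hyp_coeff n m * v m)"
    using sum_lessThan_telescope[of "\<lambda>m. hyp_tail n t m * v m" n] by (simp add: sum.distrib)
  also have "hyp_tail n t n = hyp_coeff n n"
    by (simp add: hyp_tail_def)
  finally show ?thesis
    using assms by (simp flip: lessThan_Suc_atMost)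
qed

text \<open>
  The reduction of \<open>U\<^sup>p\<^sup>+\<^sup>1\<close> at the coefficients of \<open>X, \<dots>, X\<^sup>n\<close>, which vanish because \<open>n \<le> p\<close>.
\<close>

lemma pencil_mult_expand_coeff:
  assumes "n \<le> p" "p < 2 * n" "i < n"
  shows "(\<Sum>l<n. hankel_pencil n y $$ (i, l) * expand_coeff p l) =
    (\<Sum>l<n. ternary_hankel n $$ (i, l) * (- expand_coeff (Suc p) l - 2 * y * expand_coeff p l))"
proof -
  have "power_coeff (Suc p) (Suc i) = 0"
    using assms by (intro power_coeff_eq_0) simp
  moreover have "(\<Sum>l<n. hankel_pencil n y $$ (i, l) * expand_coeff p l) =
      (\<Sum>l<n. expand_coeff p l * (3 * power_coeff 1 (Suc i + l) + power_coeff 2 (Suc i + l)))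
      - (\<Sum>l<n. 2 * y * (expand_coeff p l * power_coeff 1 (Suc i + l)))"
    unfolding sum_subtractf[symmetric] using assms
    by (intro sum.cong refl) (simp add: hankel_pencil_def algebra_simps)
  moreover have "(\<Sum>l<n. ternary_hankel n $$ (i, l) *
        (- expand_coeff (Suc p) l - 2 * y * expand_coeff p l)) =
      - (\<Sum>l<n. expand_coeff (Suc p) l * power_coeff 1 (Suc i + l))
      - (\<Sum>l<n. 2 * y * (expand_coeff p l * power_coeff 1 (Suc i + l)))"
    unfolding sum_negf[symmetric] sum_subtractf[symmetric] using assms
    by (intro sum.cong refl) (simp add: ternary_hankel_def algebra_simps)
  ultimately show ?thesis
    using power_coeff_expand[of p n "Suc i"] assms by simp
qed

lemma pencil_mult_shifted_binom:
  assumes "n \<le> p" "p < 2 * n" "i < n"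
  shows "(\<Sum>l<n. hankel_pencil n y $$ (i, l) * shifted_binom p l) =
    (\<Sum>l<n. ternary_hankel n $$ (i, l) * (shifted_binom (Suc p) l - 2 * y * shifted_binom p l))"
proof -
  have sign: "(-1) ^ Suc p * expand_coeff p l = shifted_binom p l" for p l
    by (simp add: expand_coeff_def flip: mult.assoc power_add)
  have "(\<Sum>l<n. hankel_pencil n y $$ (i, l) * shifted_binom p l) =
      (-1) ^ Suc p * (\<Sum>l<n. hankel_pencil n y $$ (i, l) * expand_coeff p l)"
    unfolding sign[symmetric] sum_distrib_left by (simp only: mult_ac)
  also have "\<dots> = (\<Sum>l<n. ternary_hankel n $$ (i, l) * (shifted_binom (Suc p) l - 2 * y * shifted_binom p l))"
    unfolding pencil_mult_expand_coeff[OF assms] sum_distrib_left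
    by (intro sum.cong refl) (simp add: sign[symmetric] algebra_simps)
  finally show ?thesis .
qed

text \<open>
  On the columns of \<open>X = binom_mat n\<close>, the pencil acts as \<open>ternary_hankel n\<close> composed with the shift
  \<open>m \<mapsto> m + 1\<close> minus \<open>2y\<close>, and by \<open>hyp_coeff_orthogonal\<close> these columns and the next one
  satisfy a linear relation with coefficients \<open>hyp_coeff n\<close>. So the determinant is, up to the factors
  stated, the characteristic polynomial of a companion matrix.
\<close>

lemma det_hankel_pencil:
  assumes B: "det (ternary_hankel n) \<noteq> 0"
  shows "hyp_coeff n n * det (hankel_pencil n y) =
    (-1) ^ n * det (ternary_hankel n) * (\<Sum>m\<le>n. hyp_coeff n m * (2 * y) ^ m)"
proof (cases n)
  case 0
  then show ?thesis
    by (simp add: hankel_pencil_def ternary_hankel_def)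
next
  case (Suc k)
  let ?J = "hyp_tail n (2 * y)"
  define X where "X = mat n n (\<lambda>(l, m). shifted_binom (n + m) l)"
  \<comment> \<open>\<open>R\<close> replaces the last column of \<open>X\<close> by its combination with the Horner values; this reduces
    the companion matrix minus \<open>2y\<close> to \<open>Z\<close>, whose last column has a single nonzero entry.\<close>
  define R where "R = mat n n (\<lambda>(i, j). if j < k then (if i = j then 1 else 0) else ?J (Suc i))"
  define Z where "Z = mat n n (\<lambda>(i, j).
    if j < k then (if i = Suc j then 1 else if i = j then - (2 * y) else 0)
    else if i = 0 then - ?J 0 else 0)"
  have carrier: "X \<in> carrier_mat n n" "R \<in> carrier_mat n n" "Z \<in> carrier_mat n n"
    "hankel_pencil n y \<in> carrier_mat n n" "ternary_hankel n \<in> carrier_mat n n"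
    by (simp_all add: X_def R_def Z_def hankel_pencil_def ternary_hankel_def)
  have dims: "dim_row (hankel_pencil n y) = n" "dim_col (hankel_pencil n y) = n"
    "dim_row (ternary_hankel n) = n" "dim_col (ternary_hankel n) = n"
    using carrier by auto
  have XR: "(X * R) $$ (l, j) = (if j < k then shifted_binom (n + j) l
      else \<Sum>m<n. ?J (Suc m) * shifted_binom (n + m) l)" if "l < n" "j < n" for l j
  proof (cases "j < k")
    case True
    have "(X * R) $$ (l, j) = (\<Sum>m<n. shifted_binom (n + m) l * (if m = j then 1 else 0))"
      using that True by (simp add: X_def R_def scalar_prod_def atLeast0LessThan)
    then show ?thesis
      using True that by (simp add: mult_delta_right)
  next
    case False
    then show ?thesis
      using that by (simp add: X_def R_def scalar_prod_def atLeast0LessThan mult.commute)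
  qed
  have XZ: "(X * Z) $$ (l, j) = (if j < k then shifted_binom (Suc (n + j)) l - 2 * y * shifted_binom (n + j) l
      else - ?J 0 * shifted_binom n l)" if "l < n" "j < n" for l j
  proof (cases "j < k")
    case True
    have split: "(if m = Suc j then 1 else if m = j then - (2 * y) else 0) =
        (if m = Suc j then 1 else 0) + (if m = j then - (2 * y) else 0)" for m
      by simp
    have "(X * Z) $$ (l, j) = (\<Sum>m<n. shifted_binom (n + m) l *
        (if m = Suc j then 1 else if m = j then - (2 * y) else 0))"
      using that True by (simp add: X_def Z_def scalar_prod_def atLeast0LessThan)
    then show ?thesis
      unfolding split distrib_left sum.distrib
      using True that Suc by (simp add: mult_delta_right del: sum.lessThan_Suc)
  next
    case False
    have "(X * Z) $$ (l, j) = (\<Sum>m<n. shifted_binom (n + m) l * (if m = 0 then - ?J 0 else 0))"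
      using that False by (simp add: X_def Z_def scalar_prod_def atLeast0LessThan)
    then show ?thesis
      using False Suc by (simp add: mult_delta_right del: sum.lessThan_Suc)
  qed
  have "hankel_pencil n y * (X * R) = ternary_hankel n * (X * Z)"
  proof (rule eq_matI)
    fix i j
    assume "i < dim_row (ternary_hankel n * (X * Z))" "j < dim_col (ternary_hankel n * (X * Z))"
    then have ij: "i < n" "j < n"
      by (simp_all add: Z_def dims)
    have "(hankel_pencil n y * (X * R)) $$ (i, j) =
        (\<Sum>l<n. hankel_pencil n y $$ (i, l) * (X * R) $$ (l, j))"
      using ij carrier by (simp add: dims scalar_prod_def atLeast0LessThan row_def col_def X_def R_def)
    also have "\<dots> = (\<Sum>l<n. ternary_hankel n $$ (i, l) * (X * Z) $$ (l, j))"
    proof (cases "j < k")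
      case True
      then show ?thesis
        using pencil_mult_shifted_binom[of n "n + j" i y] ij Suc by (simp add: XR XZ del: sum.lessThan_Suc)
    next
      case False
      have orth: "(\<Sum>m<n. ?J (Suc m) * (shifted_binom (Suc (n + m)) l - 2 * y * shifted_binom (n + m) l))
          = - ?J 0 * shifted_binom n l" if "l < n" for l
        using sum_hyp_tail[of n "\<lambda>m. shifted_binom (n + m) l" "2 * y"]
          hyp_coeff_orthogonal[OF that] by (simp add: shifted_binom_def del: binomial_Suc_Suc)
      have "(\<Sum>l<n. hankel_pencil n y $$ (i, l) * (X * R) $$ (l, j)) =
          (\<Sum>m<n. ?J (Suc m) * (\<Sum>l<n. hankel_pencil n y $$ (i, l) * shifted_binom (n + m) l))"
        using ij False unfolding sum_distrib_left
        by (subst sum.swap) (simp add: XR sum_distrib_left mult_ac del: sum.lessThan_Suc)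
      also have "\<dots> = (\<Sum>m<n. ?J (Suc m) * (\<Sum>l<n. ternary_hankel n $$ (i, l)
          * (shifted_binom (Suc (n + m)) l - 2 * y * shifted_binom (n + m) l)))"
        using ij by (intro sum.cong refl) (simp add: pencil_mult_shifted_binom)
      also have "\<dots> = (\<Sum>l<n. ternary_hankel n $$ (i, l)
          * (\<Sum>m<n. ?J (Suc m) * (shifted_binom (Suc (n + m)) l - 2 * y * shifted_binom (n + m) l)))"
        unfolding sum_distrib_left by (subst sum.swap) (simp only: mult_ac)
      also have "\<dots> = (\<Sum>l<n. ternary_hankel n $$ (i, l) * (X * Z) $$ (l, j))"
        using ij False by (intro sum.cong refl) (simp add: orth XZ)
      finally show ?thesis .
    qed
    also have "\<dots> = (ternary_hankel n * (X * Z)) $$ (i, j)"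
      using ij carrier by (simp add: dims scalar_prod_def atLeast0LessThan row_def col_def X_def Z_def)
    finally show "(hankel_pencil n y * (X * R)) $$ (i, j) = (ternary_hankel n * (X * Z)) $$ (i, j)" .
  qed (simp_all add: dims R_def Z_def)
  then have "det (hankel_pencil n y * (X * R)) = det (ternary_hankel n * (X * Z))"
    by simp
  then have dets: "det (hankel_pencil n y) * (det X * det R) =
      det (ternary_hankel n) * (det X * det Z)"
    using carrier by (simp add: det_mult[where n = n])
  have detR: "det R = hyp_coeff n n"
  proof -
    have "diag_mat R = replicate k 1 @ [hyp_coeff n n]"
      by (rule nth_equalityI)
        (auto simp: diag_mat_def R_def Suc nth_append hyp_tail_def less_Suc_eq simp del: upt_Suc)
    moreover have "upper_triangular R"
      by (auto simp: upper_triangular_def R_def Suc)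
    ultimately show ?thesis
      using det_upper_triangular[of R n] carrier(2) by simp
  qed
  have detZ: "det Z = (-1) ^ n * ?J 0"
  proof -
    have "det Z = (\<Sum>i<n. Z $$ (i, k) * cofactor Z i k)"
      by (rule laplace_expansion_column[OF carrier(3)]) (simp add: Suc)
    also have "\<dots> = Z $$ (0, k) * cofactor Z 0 k"
      unfolding Suc by (subst sum.lessThan_Suc_shift) (simp add: Z_def Suc)
    also have "cofactor Z 0 k = (-1) ^ k"
    proof -
      let ?D = "mat_delete Z 0 k"
      have D: "?D = mat k k (\<lambda>(i, j). if i = j then 1 else if Suc i = j then - (2 * y) else 0)"
        by (rule eq_matI) (auto simp: mat_delete_def Z_def Suc)
      have "diag_mat ?D = replicate k 1"
        by (rule nth_equalityI) (auto simp: D diag_mat_def)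
      moreover have "upper_triangular ?D"
        by (auto simp: D upper_triangular_def)
      moreover have "?D \<in> carrier_mat k k"
        by (simp add: D)
      ultimately show ?thesis
        using det_upper_triangular[of ?D k] by (simp add: cofactor_def)
    qed
    finally show ?thesis
      by (simp add: Z_def Suc)
  qed
  have "det X \<noteq> 0"
    using det_binom_mat_nonzero[OF B] by (simp add: X_def binom_mat_def)
  with dets have "det (hankel_pencil n y) * hyp_coeff n n = det (ternary_hankel n) * ((-1) ^ n * ?J 0)"
    by (simp add: detR detZ)
  then show ?thesis
    by (simp add: hyp_tail_def lessThan_Suc_atMost mult_ac)
qed

text \<open>
  The induction uses that \<open>det (ternary_hankel (Suc n))\<close> is the value of the pencil determinant at
  \<open>y = 0\<close>, hence a nonzero multiple of \<open>det (ternary_hankel n)\<close>.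
\<close>

lemma det_ternary_hankel_nonzero: "det (ternary_hankel n) \<noteq> 0"
proof (induction n)
  case 0
  show ?case by (simp add: ternary_hankel_def)
next
  case (Suc n)
  have "(\<Sum>m\<le>n. hyp_coeff n m * (2 * 0) ^ m) = 1"
    by (simp add: sum.atMost_shift)
  then have "hyp_coeff n n * det (hankel_pencil n 0) \<noteq> 0"
    using det_hankel_pencil[OF Suc, of 0] Suc by simp
  then show ?case
    by (simp add: det_ternary_hankel_Suc)
qed

section \<open>The differential equation\<close>

text \<open>
  The polynomial \<open>\<^sub>2F\<^sub>1(-n, 3n + 3; 2n + 5/2; (x - 1) / 2)\<close> in \<open>x\<close>.
\<close>

definition hyp_poly :: "nat \<Rightarrow> real poly" where
  "hyp_poly n = (\<Sum>m\<le>n. smult (hyp_coeff n m * 2 ^ m) ([:-1, 1:] ^ m))"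

lemma H_eq_smult_hyp_poly: "\<exists>c. H n = smult c (hyp_poly n)"
proof
  let ?c = "(-1) ^ n * det (ternary_hankel n) / hyp_coeff n n"
  have "poly (H n) x = poly (smult ?c (hyp_poly n)) x" for x
  proof -
    interpret comm_ring_hom "\<lambda>p :: real poly. poly p x"
      by unfold_locales auto
    have "poly (H n) x = det (map_mat (\<lambda>p. poly p x) (mat (Suc n) (Suc n) (\<lambda>(i, j). a (i + j))))"
      by (simp add: H_def hom_det)
    also have "map_mat (\<lambda>p. poly p x) (mat (Suc n) (Suc n) (\<lambda>(i, j). a (i + j))) =
        mat (Suc n) (Suc n) (\<lambda>(i, j). poly (a (i + j)) x)"
      by (rule eq_matI) auto
    also have "det \<dots> = det (hankel_pencil n (x - 1))"
      by (rule det_a_hankel)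
    also have "\<dots> = ?c * (\<Sum>m\<le>n. hyp_coeff n m * (2 * (x - 1)) ^ m)"
      using det_hankel_pencil[OF det_ternary_hankel_nonzero, of n "x - 1"] hyp_coeff_nonzero[of n n]
      by (simp add: field_simps)
    also have "\<dots> = poly (smult ?c (hyp_poly n)) x"
    proof -
      have "poly [:-1, 1:] x = x - 1" by simp
      then show ?thesis
        by (simp only: hyp_poly_def poly_smult poly_sum poly_power power_mult_distrib mult.assoc)
    qed
    finally show ?thesis .
  qed
  then show "H n = smult ?c (hyp_poly n)"
    by (simp add: fun_eq_iff flip: poly_eq_poly_eq_iff)
qed

lemma poly_hyp_poly_ode:
  fixes u :: real
  shows "(u - 1) * (u - 3) * poly (pderiv (pderiv (hyp_poly n))) u
    + (2 * (real n + 2) * (u - 3) + 3) * poly (pderiv (hyp_poly n)) u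
    - 3 * real n * (real n + 1) * poly (hyp_poly n) u = 0"
proof -
  define t where "t = u - 1"
  have pderiv_pow: "pderiv ([:-1, 1:] ^ m) = smult (real m) ([:-1, 1:] ^ (m - 1))" for m
    by (simp add: pderiv_power pderiv_pCons)
  have pderiv_of_sum: "pderiv (sum f A) = (\<Sum>m\<in>A. pderiv (f m))"
    for f :: "nat \<Rightarrow> real poly" and A
    using higher_pderiv_sum[of 1 f A] by simp
  define h where "h m = hyp_coeff n m * 2 ^ m" for m
  have p0: "poly (hyp_poly n) u = (\<Sum>m\<le>n. h m * t ^ m)"
    by (simp add: hyp_poly_def poly_sum h_def t_def)
  have d1: "pderiv (hyp_poly n) = (\<Sum>m\<le>n. smult (h m) (smult (real m) ([:-1, 1:] ^ (m - 1))))"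
    by (simp only: hyp_poly_def pderiv_of_sum pderiv_smult pderiv_pow h_def)
  have p1: "poly (pderiv (hyp_poly n)) u = (\<Sum>m\<le>n. h m * (real m * t ^ (m - 1)))"
    by (simp add: d1 poly_sum t_def mult.assoc)
  have p2: "poly (pderiv (pderiv (hyp_poly n))) u =
      (\<Sum>m\<le>n. h m * (real m * (real (m - 1) * t ^ (m - 1 - 1))))"
    by (simp add: d1 pderiv_of_sum pderiv_smult pderiv_pow poly_sum t_def mult.assoc)
  \<comment> \<open>The differential operator maps \<open>t ^ m\<close> to a combination of \<open>t ^ m\<close> and \<open>t ^ (m - 1)\<close>, and
    the recursion of the coefficients makes the sum telescope.\<close>
  define T where "T m = h m * (real m * (2 * real m + 4 * real n + 3)) * t ^ (m - 1)" for m
  have T_Suc: "T (Suc m) = h m * ((real m - real n) * (real m + 3 * real n + 3)) * t ^ m" for m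
  proof -
    have "T (Suc m) = hyp_coeff n (Suc m) * (2 * (real m + 1) * (2 * real m + 4 * real n + 5)) * 2 ^ m * t ^ m"
      by (simp add: T_def h_def algebra_simps)
    then show ?thesis
      unfolding hyp_coeff_rec by (simp add: h_def mult_ac)
  qed
  have summand: "t * (t - 2) * (real m * (real (m - 1) * t ^ (m - 1 - 1)))
      + (2 * (real n + 2) * (t - 2) + 3) * (real m * t ^ (m - 1))
      - 3 * real n * (real n + 1) * t ^ m
    = (real m - real n) * (real m + 3 * real n + 3) * t ^ m
      - real m * (2 * real m + 4 * real n + 3) * t ^ (m - 1)" for m
  proof -
    consider "m = 0" | "m = 1" | k where "m = Suc (Suc k)"
      by (metis One_nat_def not0_implies_Suc)
    then show ?thesis
      by cases (simp_all add: algebra_simps)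
  qed
  have u: "u - 1 = t" "u - 3 = t - 2"
    by (simp_all add: t_def)
  have "(u - 1) * (u - 3) * poly (pderiv (pderiv (hyp_poly n))) u
      + (2 * (real n + 2) * (u - 3) + 3) * poly (pderiv (hyp_poly n)) u
      - 3 * real n * (real n + 1) * poly (hyp_poly n) u
    = (\<Sum>m\<le>n. h m * (t * (t - 2) * (real m * (real (m - 1) * t ^ (m - 1 - 1)))
        + (2 * (real n + 2) * (t - 2) + 3) * (real m * t ^ (m - 1))
        - 3 * real n * (real n + 1) * t ^ m))"
    unfolding p0 p1 p2 u sum_distrib_left sum.distrib[symmetric] sum_subtractf[symmetric]
    by (intro sum.cong refl) (simp only: distrib_left right_diff_distrib mult_ac)
  also have "\<dots> = (\<Sum>m\<le>n. T (Suc m) - T m)"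
    unfolding summand T_Suc by (simp add: T_def right_diff_distrib mult_ac)
  also have "\<dots> = T (Suc n) - T 0"
    using sum_telescope[of T n] by (simp add: sum_subtractf)
  also have "\<dots> = 0"
    by (subst T_Suc) (simp add: T_def)
  finally show ?thesis .
qed

theorem theorem1:
  fixes n :: nat and x y :: "real poly"
  defines "x \<equiv> [:0, 1:]"
    and "y \<equiv> H n"
  shows "(x - 1) * (x - 3) * pderiv (pderiv y)
       + (2 * (of_nat n + 2) * (x - 3) + 3) * pderiv y
       - 3 * of_nat n * (of_nat n + 1) * y = 0"
proof -
  obtain c where y: "y = smult c (hyp_poly n)"
    using H_eq_smult_hyp_poly unfolding y_def by blast
  have "poly ((x - 1) * (x - 3) * pderiv (pderiv y)
      + (2 * (of_nat n + 2) * (x - 3) + 3) * pderiv y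
      - 3 * of_nat n * (of_nat n + 1) * y) u = 0" for u
  proof -
    have "poly ((x - 1) * (x - 3) * pderiv (pderiv y)
        + (2 * (of_nat n + 2) * (x - 3) + 3) * pderiv y
        - 3 * of_nat n * (of_nat n + 1) * y) u =
      c * ((u - 1) * (u - 3) * poly (pderiv (pderiv (hyp_poly n))) u
        + (2 * (real n + 2) * (u - 3) + 3) * poly (pderiv (hyp_poly n)) u
        - 3 * real n * (real n + 1) * poly (hyp_poly n) u)"
      by (simp add: x_def y pderiv_smult algebra_simps)
    then show ?thesis
      by (simp only: poly_hyp_poly_ode)
  qed
  then show ?thesis
    by (simp add: fun_eq_iff flip: poly_eq_poly_eq_iff)
qed

end
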